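(* Let $NP$ be the negative plurality social choice correspondence. (1) If $|A|=3$ and $3$ divides $|I|-1$, then $NP$ is $\mathbf{K}$-manipulable and $\Omega^{NP}$-$\mathbf{K}$-strategy-proof. (2) If $|A|=3$ and $3$ does not divide $|I|-1$, then $NP$ is $\Omega^{NP}$-$\mathbf{K}$-manipulable. (3) If $|A|\ge 4$ and $|I|<|A|-1$, then $NP$ is $\mathbf{K}$-strategy-proof. (4) If $|A|\ge 4$ and $|I|\ge |A|-1$, then $NP$ is $\mathbf{K}$-manipulable and $\Omega^{NP}$-$\mathbf{K}$-strategy-proof.
   Context: Standing setting: $A$ (alternatives) and $I$ (individuals) are finite sets with $|A|\ge 2$, $|I|\ge 2$. $P_0(X)$ is the set of nonempty subsets of $X$. For a relation $R$ on a set $X$, $x\succeq_R y$ means $(x,y)\in R$, and $x\succ_R y$ means $(x,y)\in R$ and $(y,x)\notin R$. $\mathcal{L}(A)$ is the set of linear orders (complete, transitive, antisymmetric relations) on $A$; for $q\in\mathcal{L}(A)$, $\mathrm{rank}_q(x)=|\{y\in A: y\succeq_q x\}|$ (so rank $1$ is best and rank $|A|$ is worst). For $J\subseteq I$, $\mathcal{L}(A)^J$ is the set of functions $J\to\mathcal{L}(A)$. For $i\in I$, $\overline{p}\in\mathcal{L}(A)^{I\setminus\{i\}}$, $q\in\mathcal{L}(A)$, $(\overline{p},q[i])\in\mathcal{L}(A)^I$ is the profile equal to $q$ at $i$ and to $\overline{p}(j)$ at every $j\ne i$. A social choice correspondence (scc) is a function $F:\mathcal{L}(A)^I\to P_0(A)$.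 Negative plurality: for $p\in\mathcal{L}(A)^I$, $NP(p)=\mathrm{argmax}_{x\in A}|\{i\in I:\mathrm{rank}_{p(i)}(x)\neq|A|\}|$ (set of all maximizers). Kelly extension rule: for $q\in\mathcal{L}(A)$, $\mathbf{K}(q)$ is the relation on $P_0(A)$ given by $(B,C)\in\mathbf{K}(q)$ iff $B=C$ or $x\succeq_q y$ for all $x\in B$, $y\in C$. A scc $F$ is $\mathbf{K}$-manipulable if there exist $i\in I$, $q,q'\in\mathcal{L}(A)$ and $\overline{p}\in\mathcal{L}(A)^{I\setminus\{i\}}$ with $F(\overline{p},q'[i])\succ_{\mathbf{K}(q)}F(\overline{p},q[i])$; it is $\mathbf{K}$-strategy-proof if it is not $\mathbf{K}$-manipulable. Winner information: for a scc $F$, $i\in I$, $q\in\mathcal{L}(A)$, $\Omega^F_i(q)=\big\{\{\overline{p}\in\mathcal{L}(A)^{I\setminus\{i\}}:F(\overline{p},q[i])=X\}: X\in\mathrm{Im}(F)\big\}\setminus\{\varnothing\}$. A scc $F$ is $\Omega^F$-$\mathbf{K}$-manipulable if there exist $i\in I$, $q,q'\in\mathcal{L}(A)$ and $\omega\in\Omega^F_i(q)$ such that $F(\overline{p}',q'[i])\succ_{\mathbf{K}(q)}F(\overline{p}',q[i])$ for some $\overline{p}'\in\omega$, and $F(\overline{p},q'[i])\succeq_{\mathbf{K}(q)}F(\overline{p},q[i])$ for every $\overline{p}\in\omega$; it is $\Omega^F$-$\mathbf{K}$-strategy-proof if it is not $\Omega^F$-$\mathbf{K}$-manipulable. *)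

theory Defs
  imports "HOL-Library.FuncSet"
begin

text \<open>In a preference relation, (x, y) means that x is at least as good as y.\<close>

definition nonempty_subsets :: "'a set \<Rightarrow> 'a set set" where
  "nonempty_subsets X = Pow X - {{}}"

definition weakly_prefers :: "'x rel \<Rightarrow> 'x \<Rightarrow> 'x \<Rightarrow> bool" where
  "weakly_prefers R x y \<longleftrightarrow> (x, y) \<in> R"

definition strictly_prefers :: "'x rel \<Rightarrow> 'x \<Rightarrow> 'x \<Rightarrow> bool" where
  "strictly_prefers R x y \<longleftrightarrow> (x, y) \<in> R \<and> (y, x) \<notin> R"

definition linear_orders :: "'a set \<Rightarrow> 'a rel set" where
  "linear_orders A = {q. linear_order_on A q}"

definition rank :: "'a set \<Rightarrow> 'a rel \<Rightarrow> 'a \<Rightarrow> nat" where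
  "rank A q x = card {y \<in> A. weakly_prefers q y x}"

text \<open>Functions from \<open>J\<close> to the linear orders are extensional (undefined outside \<open>J\<close>), so that
  distinct elements are distinct as functions on \<open>J\<close>. For \<open>p\<close> in \<open>profiles A (I - {i})\<close> the
  profile that adds the preference \<open>q\<close> of individual \<open>i\<close> is the function update \<open>p(i := q)\<close>.\<close>

definition profiles :: "'a set \<Rightarrow> 'i set \<Rightarrow> ('i \<Rightarrow> 'a rel) set" where
  "profiles A J = J \<rightarrow>\<^sub>E linear_orders A"

lemma profiles_update:
  assumes "i \<in> I" "p \<in> profiles A (I - {i})" "q \<in> linear_orders A"
  shows "p(i := q) \<in> profiles A I"
  using assms by (auto simp: profiles_def PiE_iff extensional_def)

definition is_scc :: "'a set \<Rightarrow> 'i set \<Rightarrow> (('i \<Rightarrow> 'a rel) \<Rightarrow> 'a set) \<Rightarrow> bool" where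
  "is_scc A I F \<longleftrightarrow> F \<in> profiles A I \<rightarrow> nonempty_subsets A"

definition negative_plurality :: "'a set \<Rightarrow> 'i set \<Rightarrow> ('i \<Rightarrow> 'a rel) \<Rightarrow> 'a set" where
  "negative_plurality A I p =
     {x. is_arg_max (\<lambda>x. card {i \<in> I. rank A (p i) x \<noteq> card A}) (\<lambda>x. x \<in> A) x}"

lemma negative_plurality_is_scc:
  assumes "finite A" "A \<noteq> {}"
  shows "is_scc A I (negative_plurality A I)"
proof -
  have "negative_plurality A I p \<noteq> {}" for p :: "'b \<Rightarrow> 'a rel"
  proof -
    let ?f = "\<lambda>x. card {i \<in> I. rank A (p i) x \<noteq> card A}"
    have "Max (?f ` A) \<in> ?f ` A"
      using assms by (intro Max_in) auto
    then obtain x where "x \<in> A" "?f x = Max (?f ` A)"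
      by auto
    then have "is_arg_max ?f (\<lambda>x. x \<in> A) x"
      using assms(1) by (simp add: is_arg_max_linorder)
    then show ?thesis
      unfolding negative_plurality_def by blast
  qed
  then show ?thesis
    by (auto simp: is_scc_def nonempty_subsets_def negative_plurality_def is_arg_max_def)
qed

definition kelly :: "'a set \<Rightarrow> 'a rel \<Rightarrow> 'a set rel" where
  "kelly A q = {(B, C). B \<in> nonempty_subsets A \<and> C \<in> nonempty_subsets A \<and>
     (B = C \<or> (\<forall>x\<in>B. \<forall>y\<in>C. weakly_prefers q x y))}"

definition K_manipulable :: "'a set \<Rightarrow> 'i set \<Rightarrow> (('i \<Rightarrow> 'a rel) \<Rightarrow> 'a set) \<Rightarrow> bool" where
  "K_manipulable A I F \<longleftrightarrow>
     (\<exists>i\<in>I. \<exists>q\<in>linear_orders A. \<exists>q'\<in>linear_orders A. \<exists>p\<in>profiles A (I - {i}).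
        strictly_prefers (kelly A q) (F (p(i := q'))) (F (p(i := q))))"

definition K_strategy_proof :: "'a set \<Rightarrow> 'i set \<Rightarrow> (('i \<Rightarrow> 'a rel) \<Rightarrow> 'a set) \<Rightarrow> bool" where
  "K_strategy_proof A I F \<longleftrightarrow> \<not> K_manipulable A I F"

definition winner_info ::
  "'a set \<Rightarrow> 'i set \<Rightarrow> (('i \<Rightarrow> 'a rel) \<Rightarrow> 'a set) \<Rightarrow> 'i \<Rightarrow> 'a rel \<Rightarrow> ('i \<Rightarrow> 'a rel) set set" where
  "winner_info A I F i q =
     {{p \<in> profiles A (I - {i}). F (p(i := q)) = X} | X. X \<in> F ` profiles A I} - {{}}"

definition winner_K_manipulable :: "'a set \<Rightarrow> 'i set \<Rightarrow> (('i \<Rightarrow> 'a rel) \<Rightarrow> 'a set) \<Rightarrow> bool" where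
  "winner_K_manipulable A I F \<longleftrightarrow>
     (\<exists>i\<in>I. \<exists>q\<in>linear_orders A. \<exists>q'\<in>linear_orders A. \<exists>\<omega>\<in>winner_info A I F i q.
        (\<exists>p\<in>\<omega>. strictly_prefers (kelly A q) (F (p(i := q'))) (F (p(i := q)))) \<and>
        (\<forall>p\<in>\<omega>. weakly_prefers (kelly A q) (F (p(i := q'))) (F (p(i := q)))))"

definition winner_K_strategy_proof :: "'a set \<Rightarrow> 'i set \<Rightarrow> (('i \<Rightarrow> 'a rel) \<Rightarrow> 'a set) \<Rightarrow> bool" where
  "winner_K_strategy_proof A I F \<longleftrightarrow> \<not> winner_K_manipulable A I F"

end

theory Submission
  imports Defs
begin

text \<open>Negative plurality selects the alternatives with the fewest vetoes, a veto being a last place.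
  Fix the vetoes \<open>c\<close> of the others and let the individual's sincere veto be \<open>z\<close>. A veto of \<open>z'\<close>
  can only help if \<open>z\<close> is not least vetoed under \<open>c\<close> and the sincere outcome is \<open>{y, z'}\<close>
  (possibly \<open>y = z'\<close>); so everything outside \<open>{y, z'}\<close> is vetoed by the others, which takes
  \<open>|I| - 1 \<ge> |A| - 2\<close>. The winner information cannot separate this from the others vetoing \<open>y\<close>, \<open>z'\<close>
  and \<open>z\<close> equally often and less than the rest, where vetoing \<open>z'\<close> makes \<open>z\<close> win. Such
  vetoes exist unless \<open>A = {y, z', z}\<close> and 3 does not divide \<open>|I| - 1\<close>;
  in that case a sincere outcome \<open>{y, z'}\<close> forces \<open>z\<close> to have strictly more vetoes, so vetoing
  \<open>z'\<close> always leaves \<open>y\<close> alone.\<close>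

section \<open>Bottom alternatives of linear orders\<close>

text \<open>The vetoed alternative, described by the order alone instead of by \<open>rank\<close>;
  antisymmetry makes the description unique on linear orders.\<close>

definition bottom :: "'a set \<Rightarrow> 'a rel \<Rightarrow> 'a" where
  "bottom A q = (THE x. x \<in> A \<and> (\<forall>y\<in>A. (y, x) \<in> q))"

lemma bottom_eqI:
  assumes "q \<in> linear_orders A" "x \<in> A" "\<And>y. y \<in> A \<Longrightarrow> (y, x) \<in> q"
  shows "bottom A q = x"
  unfolding bottom_def
  using assms
  by (intro the_equality)
    (auto simp: linear_orders_def linear_order_on_def partial_order_on_def dest: antisymD)

text \<open>Induction over the finite nonempty subsets of \<open>A\<close>: a new element either
  leaves the old bottom in place or, by transitivity, takes it over.\<close>

lemma ex_bottom:
  assumes "finite A" "A \<noteq> {}" "q \<in> linear_orders A"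
  shows "\<exists>x\<in>A. \<forall>y\<in>A. (y, x) \<in> q"
proof -
  have refl: "(x, x) \<in> q" if "x \<in> A" for x
    using assms(3) that
    by (auto simp: linear_orders_def linear_order_on_def partial_order_on_def preorder_on_def
        refl_on_def)
  have trans: "trans q"
    using assms(3)
    by (auto simp: linear_orders_def linear_order_on_def partial_order_on_def preorder_on_def)
  have total: "(x, y) \<in> q \<or> (y, x) \<in> q" if "x \<in> A" "y \<in> A" for x y
    using assms(3) that refl[of y]
    by (cases "x = y") (auto simp: linear_orders_def linear_order_on_def total_on_def)
  have "B \<subseteq> A \<Longrightarrow> \<exists>x\<in>B. \<forall>y\<in>B. (y, x) \<in> q" if "finite B" "B \<noteq> {}" for B
    using that
  proof (induction B rule: finite_ne_induct)
    case (singleton x)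
    then show ?case using refl by auto
  next
    case (insert b B)
    then obtain x where x: "x \<in> B" "\<forall>y\<in>B. (y, x) \<in> q" by auto
    show ?case
    proof (cases "(b, x) \<in> q")
      case True
      then show ?thesis using x by auto
    next
      case False
      then have "(x, b) \<in> q" using total[of x b] x insert.prems by blast
      then have "\<forall>y\<in>B. (y, b) \<in> q" using x trans by (meson transD)
      then show ?thesis using refl insert.prems by blast
    qed
  qed
  then show ?thesis using assms by blast
qed

lemma
  assumes "finite A" "A \<noteq> {}" "q \<in> linear_orders A"
  shows bottom_in: "bottom A q \<in> A"
    and bottom_le: "y \<in> A \<Longrightarrow> (y, bottom A q) \<in> q"
    and le_bottomD: "x \<in> A \<Longrightarrow> (bottom A q, x) \<in> q \<Longrightarrow> x = bottom A q"
proof -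
  obtain x where x: "x \<in> A" "\<forall>y\<in>A. (y, x) \<in> q"
    using ex_bottom[OF assms] by blast
  then have "bottom A q = x"
    using bottom_eqI[OF assms(3)] by blast
  then show *: "bottom A q \<in> A" "y \<in> A \<Longrightarrow> (y, bottom A q) \<in> q" for y
    using x by auto
  show "x \<in> A \<Longrightarrow> (bottom A q, x) \<in> q \<Longrightarrow> x = bottom A q" for x
    using *(2) assms(3)
    by (auto simp: linear_orders_def linear_order_on_def partial_order_on_def dest: antisymD)
qed

text \<open>A subset of a finite set has full cardinality only if it is the whole set. This replaces
  \<open>rank\<close> by \<open>bottom\<close> from here on.\<close>

lemma rank_eq_card_iff:
  assumes "finite A" "q \<in> linear_orders A" "x \<in> A"
  shows "rank A q x = card A \<longleftrightarrow> bottom A q = x"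
proof -
  have "rank A q x = card A \<longleftrightarrow> {y \<in> A. (y, x) \<in> q} = A"
    using card_subset_eq[of A "{y \<in> A. (y, x) \<in> q}"] assms(1)
    by (auto simp: rank_def weakly_prefers_def)
  also have "\<dots> \<longleftrightarrow> bottom A q = x"
    using assms bottom_eqI[OF assms(2,3)] bottom_le[of A q] by blast
  finally show ?thesis .
qed

lemma linear_order_on_insert_bottom:
  assumes "linear_order_on B r" "z \<notin> B"
  shows "linear_order_on (insert z B) (r \<union> insert z B \<times> {z})"
proof -
  have "r \<subseteq> B \<times> B" "\<And>x. x \<in> B \<Longrightarrow> (x, x) \<in> r" "trans r" "antisym r"
    "\<And>x y. x \<in> B \<Longrightarrow> y \<in> B \<Longrightarrow> x \<noteq> y \<Longrightarrow> (x, y) \<in> r \<or> (y, x) \<in> r"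
    using assms(1)
    by (auto simp: linear_order_on_def partial_order_on_def preorder_on_def refl_on_def
        total_on_def)
  then show ?thesis
    using assms(2)
    unfolding linear_order_on_def partial_order_on_def preorder_on_def refl_on_def total_on_def
      trans_def antisym_def
    by (intro conjI; blast)
qed

text \<open>Order the remaining alternatives arbitrarily, then append \<open>z'\<close> and
  \<open>z\<close>. With \<open>z'\<close> next to last, a manipulator who sincerely vetoes
  \<open>z\<close> likes every other alternative at least as much as \<open>z'\<close>.\<close>

lemma ex_linear_order_bottom_two:
  assumes "z \<in> A" "z' \<in> A" "z \<noteq> z'"
  shows "\<exists>q\<in>linear_orders A. bottom A q = z \<and> (\<forall>y\<in>A - {z}. (y, z') \<in> q)"
proof -
  define B where "B = A - {z, z'}"
  obtain r where "linear_order_on B r"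
    using well_order_on[of B] by (auto simp: well_order_on_def)
  then have "linear_order_on (insert z' B) (r \<union> insert z' B \<times> {z'})"
    by (rule linear_order_on_insert_bottom) (simp add: B_def)
  then have *: "linear_order_on (insert z (insert z' B))
      ((r \<union> insert z' B \<times> {z'}) \<union> insert z (insert z' B) \<times> {z})" (is "linear_order_on _ ?q")
    by (rule linear_order_on_insert_bottom) (use assms in \<open>simp add: B_def\<close>)
  moreover have A: "insert z (insert z' B) = A"
    using assms by (auto simp: B_def)
  ultimately have "?q \<in> linear_orders A"
    by (simp add: linear_orders_def)
  moreover have "bottom A ?q = z"
    using assms calculation A by (intro bottom_eqI) auto
  moreover have "\<forall>y\<in>A - {z}. (y, z') \<in> ?q"
    using A by auto
  ultimately show ?thesis by blast
qed

lemma ex_linear_order_bottom: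
  assumes "z \<in> A"
  shows "\<exists>q\<in>linear_orders A. bottom A q = z"
proof -
  obtain r where "linear_order_on (A - {z}) r"
    using well_order_on[of "A - {z}"] by (auto simp: well_order_on_def)
  then have "linear_order_on (insert z (A - {z})) (r \<union> insert z (A - {z}) \<times> {z})"
    by (rule linear_order_on_insert_bottom) simp
  then have "r \<union> A \<times> {z} \<in> linear_orders A"
    using assms by (simp add: linear_orders_def insert_absorb)
  then show ?thesis
    using assms by (intro bexI[of _ "r \<union> A \<times> {z}"] bottom_eqI) auto
qed

section \<open>Vetoes\<close>

definition vetoes :: "'a set \<Rightarrow> 'i set \<Rightarrow> ('i \<Rightarrow> 'a rel) \<Rightarrow> 'a \<Rightarrow> nat" where
  "vetoes A J p x = card {j \<in> J. bottom A (p j) = x}"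

text \<open>The outcome when the others' vetoes are counted by \<open>c\<close> and one more veto
  falls on \<open>z\<close>. Working with bare counts keeps the comparison of two vetoes free of
  profiles.\<close>

definition least_vetoed :: "'a set \<Rightarrow> ('a \<Rightarrow> nat) \<Rightarrow> 'a \<Rightarrow> 'a set" where
  "least_vetoed A c z =
     {x \<in> A. \<forall>y\<in>A. c x + of_bool (x = z) \<le> c y + of_bool (y = z)}"

text \<open>Double counting: each individual vetoes exactly one alternative.\<close>

lemma sum_vetoes:
  assumes "finite A" "A \<noteq> {}" "finite J" "p \<in> profiles A J"
  shows "sum (vetoes A J p) A = card J"
proof -
  have "{x \<in> A. bottom A (p j) = x} = {bottom A (p j)}" if "j \<in> J" for j
    using assms that bottom_in[of A "p j"] by (auto simp: profiles_def)
  then have "(\<Sum>x\<in>A. card {j \<in> J. bottom A (p j) = x}) = 1 * card J"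
    using assms by (intro sum_multicount) auto
  then show ?thesis by (simp add: vetoes_def)
qed

lemma vetoes_fun_upd:
  assumes "finite I" "i \<in> I"
  shows "vetoes A I (p(i := q)) x = vetoes A (I - {i}) p x + of_bool (x = bottom A q)"
proof -
  have "{j \<in> I. bottom A ((p(i := q)) j) = x} =
      {j \<in> I - {i}. bottom A (p j) = x} \<union> (if x = bottom A q then {i} else {})"
    using assms(2) by auto
  then show ?thesis
    using assms(1) by (simp add: vetoes_def card_insert_if)
qed

lemma negative_plurality_eq:
  assumes "finite A" "finite I" "p \<in> profiles A I"
  shows "negative_plurality A I p = {x \<in> A. \<forall>y\<in>A. vetoes A I p x \<le> vetoes A I p y}"
proof -
  \<comment> \<open>The bound keeps the subtraction from \<open>card I\<close> below from
    truncating, so that maximizing the difference is minimizing the vetoes.\<close>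
  have le: "vetoes A I p x \<le> card I" for x
    unfolding vetoes_def using assms(2) by (auto intro: card_mono)
  have "card {i \<in> I. rank A (p i) x \<noteq> card A} = card I - vetoes A I p x" if "x \<in> A" for x
  proof -
    have "rank A (p j) x = card A \<longleftrightarrow> bottom A (p j) = x" if "j \<in> I" for j
      using assms \<open>x \<in> A\<close> that by (intro rank_eq_card_iff) (auto simp: profiles_def)
    then have "{i \<in> I. rank A (p i) x \<noteq> card A} = I - {j \<in> I. bottom A (p j) = x}"
      by auto
    then show ?thesis
      using assms(2) by (simp add: vetoes_def card_Diff_subset)
  qed
  then show ?thesis
    using le by (auto simp: negative_plurality_def is_arg_max_linorder le_diff_iff')
qed

lemma negative_plurality_fun_upd:
  assumes "finite A" "finite I" "i \<in> I" "p \<in> profiles A (I - {i})" "q \<in> linear_orders A"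
  shows "negative_plurality A I (p(i := q)) =
    least_vetoed A (vetoes A (I - {i}) p) (bottom A q)"
  using assms by (simp add: negative_plurality_eq profiles_update vetoes_fun_upd least_vetoed_def)

section \<open>Profiles with prescribed veto counts\<close>

lemma ex_profile_bottoms:
  assumes "v \<in> J \<rightarrow> A"
  shows "\<exists>p\<in>profiles A J. \<forall>x. vetoes A J p x = card {j \<in> J. v j = x}"
proof -
  have "\<forall>j\<in>J. \<exists>q. q \<in> linear_orders A \<and> bottom A q = v j"
    using assms ex_linear_order_bottom[of _ A] by (metis PiE)
  then obtain p where p: "\<forall>j\<in>J. p j \<in> linear_orders A \<and> bottom A (p j) = v j"
    by metis
  then have "restrict p J \<in> profiles A J"
    by (auto simp: profiles_def)
  moreover have "vetoes A J (restrict p J) x = card {j \<in> J. v j = x}" for x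
    using p by (auto simp: vetoes_def intro!: arg_cong[of _ _ card])
  ultimately show ?thesis by blast
qed

text \<open>An injection of \<open>B\<close> into \<open>J\<close> gives each element of
  \<open>B\<close> its own vetoer; all remaining individuals veto one fixed \<open>b\<close> in
  \<open>B\<close>, so nothing outside \<open>B\<close> is hit.\<close>

lemma ex_profile_vetoes_support:
  assumes "finite J" "finite A" "B \<subseteq> A" "B \<noteq> {}" "card B \<le> card J"
  shows "\<exists>p\<in>profiles A J. \<forall>x. vetoes A J p x = 0 \<longleftrightarrow> x \<notin> B"
proof -
  obtain g where g: "g ` B \<subseteq> J" "inj_on g B"
    using card_le_inj[OF _ assms(1,5)] assms(2,3) finite_subset by metis
  obtain b where "b \<in> B" using assms(4) by blast
  define v where "v j = (if j \<in> g ` B then inv_into B g j else b)" for j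
  have v: "v \<in> J \<rightarrow> B"
    using \<open>b \<in> B\<close> by (auto simp: v_def inv_into_into[OF imageI])
  then obtain p where p: "p \<in> profiles A J" "\<forall>x. vetoes A J p x = card {j \<in> J. v j = x}"
    using ex_profile_bottoms[of v J A] assms(3) by blast
  have "v (g x) = x" "g x \<in> J" if "x \<in> B" for x
    using g that by (auto simp: v_def)
  then have "{j \<in> J. v j = x} = {} \<longleftrightarrow> x \<notin> B" for x
    using v by blast
  then show ?thesis
    using p assms(1) by (intro bexI[of _ p]) auto
qed

text \<open>Identify \<open>J\<close> with \<open>A \<times> {..<k}\<close> and let everyone veto
  the first component; each fibre then has \<open>k\<close> members.\<close>

lemma ex_profile_vetoes_const:
  assumes "finite J" "finite A" "card J = card A * k" "A \<noteq> {}"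
  shows "\<exists>p\<in>profiles A J. \<forall>x\<in>A. vetoes A J p x = k"
proof -
  have "card J = card (A \<times> {..<k})"
    using assms by (simp add: card_cartesian_product)
  then obtain h where h: "bij_betw h J (A \<times> {..<k})"
    using assms finite_same_card_bij[of J "A \<times> {..<k}"] by auto
  then have "fst \<circ> h \<in> J \<rightarrow> A"
    using bij_betw_apply by fastforce
  then obtain p where p: "p \<in> profiles A J"
      "\<forall>x. vetoes A J p x = card {j \<in> J. (fst \<circ> h) j = x}"
    using ex_profile_bottoms[of "fst \<circ> h" J A] by blast
  have "card {j \<in> J. (fst \<circ> h) j = x} = k" if "x \<in> A" for x
  proof -
    have "inj_on h {j \<in> J. (fst \<circ> h) j = x}"
      using h by (auto simp: bij_betw_def inj_on_def)
    moreover have "h ` {j \<in> J. (fst \<circ> h) j = x} = {x} \<times> {..<k}"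
    proof -
      have "{u \<in> A \<times> {..<k}. fst u = x} = {x} \<times> {..<k}"
        using that by auto
      moreover have "h ` J = A \<times> {..<k}"
        using h by (simp add: bij_betw_def)
      moreover have "h ` {j \<in> J. (fst \<circ> h) j = x} = {u \<in> h ` J. fst u = x}"
        by auto
      ultimately show ?thesis by simp
    qed
    ultimately show ?thesis
      using card_image[of h "{j \<in> J. (fst \<circ> h) j = x}"] by (simp add: card_cartesian_product)
  qed
  then show ?thesis using p by (intro bexI[of _ p]) auto
qed

section \<open>Changing a veto\<close>

lemma least_vetoed_nonempty:
  assumes "finite A" "A \<noteq> {}"
  shows "least_vetoed A c z \<noteq> {}"
proof -
  let ?f = "\<lambda>x. c x + of_bool (x = z)"
  have "arg_min_on ?f A \<in> least_vetoed A c z"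
    using arg_min_if_finite(1)[OF assms, of ?f] arg_min_least[OF assms, of _ ?f]
    by (simp add: least_vetoed_def)
  then show ?thesis by blast
qed

text \<open>A veto on an alternative that is already above the minimum changes nothing: the
  minimizers of \<open>c\<close> win.\<close>

lemma least_vetoed_not_minimal:
  assumes "x \<in> A" "\<And>u. u \<in> A \<Longrightarrow> c x \<le> c u" "c x < c z"
  shows "least_vetoed A c z = {u \<in> A. c u = c x}"
proof (intro set_eqI iffI)
  fix u assume "u \<in> least_vetoed A c z"
  then have "u \<in> A" "c u + of_bool (u = z) \<le> c x + of_bool (x = z)"
    using assms(1) by (auto simp: least_vetoed_def)
  moreover have "x \<noteq> z" using assms(3) by auto
  ultimately show "u \<in> {u \<in> A. c u = c x}"
    using assms(2)[of u] by simp
next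
  fix u assume "u \<in> {u \<in> A. c u = c x}"
  then have "u \<in> A" "c u = c x" "u \<noteq> z" using assms(3) by auto
  then show "u \<in> least_vetoed A c z"
    using assms(2) by (simp add: least_vetoed_def trans_le_add1)
qed

text \<open>As \<open>z\<close> is worst for \<open>q\<close>, an improvement cannot let
  \<open>z\<close> win either before or after the change. This forces \<open>z\<close> above the
  minimum of \<open>c\<close> and \<open>z'\<close> onto it, and antisymmetry leaves room for at
  most one winner besides \<open>z'\<close>.\<close>

lemma least_vetoed_improvement:
  assumes "finite A" "q \<in> linear_orders A" "z = bottom A q" "z' \<in> A"
    and neq: "least_vetoed A c z' \<noteq> least_vetoed A c z"
    and better: "\<forall>x\<in>least_vetoed A c z'. \<forall>y\<in>least_vetoed A c z. (x, y) \<in> q"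
  shows "\<exists>y\<in>A. y \<noteq> z \<and> z' \<noteq> z \<and> least_vetoed A c z = {y, z'} \<and>
    (\<forall>x\<in>A - {y, z'}. c x > 0)"
proof -
  let ?X = "least_vetoed A c z" and ?Y = "least_vetoed A c z'"
  have ne: "A \<noteq> {}" using assms(4) by blast
  have zA: "z \<in> A"
    using bottom_in[OF assms(1) ne assms(2)] assms(3) by simp
  have worst: "x = z" if "x \<in> A" "(z, x) \<in> q" for x
    using le_bottomD[OF assms(1) ne assms(2)] assms(3) that by simp
  have "z' \<noteq> z" using neq by blast
  have XA: "?X \<subseteq> A" by (auto simp: least_vetoed_def)
  have zY: "z \<notin> ?Y"
  proof
    assume "z \<in> ?Y"
    then have X: "?X = {z}"
      using better worst XA least_vetoed_nonempty[OF assms(1) ne, of c z] by blast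
    \<comment> \<open>Here \<open>z\<close> wins alone despite its extra veto, so it leads by at
      least two; moving that veto to \<open>z'\<close> would leave the outcome \<open>{z}\<close>
      unchanged.\<close>
    have "c z + 1 < c x" if "x \<in> A" "x \<noteq> z" for x
    proof (rule ccontr)
      assume "\<not> ?thesis"
      moreover have "z \<in> ?X" using X by blast
      then have "c z + 1 \<le> c y" if "y \<in> A" "y \<noteq> z" for y
        using that by (force simp: least_vetoed_def)
      ultimately have "x \<in> ?X"
        using that unfolding least_vetoed_def by fastforce
      then show False using X that by blast
    qed
    then have "?Y = {z}"
      using zA \<open>z' \<noteq> z\<close> unfolding least_vetoed_def by (fastforce simp: not_le)
    then show False using X neq by blast
  qed
  have zX: "z \<notin> ?X"
  proof
    assume "z \<in> ?X"
    then have "c z + 1 \<le> c u" if "u \<in> A" "u \<noteq> z" for u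
      using that by (force simp: least_vetoed_def)
    then have "z \<in> ?Y"
      using \<open>z' \<noteq> z\<close> zA unfolding least_vetoed_def by fastforce
    then show False using zY by blast
  qed
  obtain x where x: "x \<in> ?X"
    using least_vetoed_nonempty[OF assms(1) ne] by blast
  then have xz: "x \<in> A" "x \<noteq> z" using zX XA by auto
  have min: "c x \<le> c u" if "u \<in> A" "u \<noteq> z" for u
    using x that xz by (force simp: least_vetoed_def)
  \<comment> \<open>If \<open>z\<close> were strictly below the others, one more veto would still
    leave it winning sincerely; if it were level with the minimum, it would win once its veto is
    moved to \<open>z'\<close>.\<close>
  have "c x \<le> c z"
  proof (rule ccontr)
    assume "\<not> ?thesis"
    then have "z \<in> ?X" using min zA unfolding least_vetoed_def by force
    then show False using zX by blast
  qed
  moreover have "c z \<noteq> c x"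
  proof
    assume "c z = c x"
    then have "z \<in> ?Y"
      using min \<open>z' \<noteq> z\<close> zA unfolding least_vetoed_def by force
    then show False using zY by blast
  qed
  ultimately have cz: "c x < c z" by simp
  have min': "c x \<le> c u" if "u \<in> A" for u
    using that min cz by (cases "u = z") auto
  have X: "?X = {u \<in> A. c u = c x}"
    using xz(1) min' cz by (rule least_vetoed_not_minimal)
  \<comment> \<open>Otherwise both \<open>z\<close> and \<open>z'\<close> lie above the minimum, and
    either veto yields the same minimizers.\<close>
  have z'X: "z' \<in> ?X"
  proof (rule ccontr)
    assume "z' \<notin> ?X"
    then have "c x < c z'" using X min'[OF assms(4)] assms(4) by auto
    with xz(1) min' have "?Y = {u \<in> A. c u = c x}"
      by (rule least_vetoed_not_minimal)
    then show False using X neq by blast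
  qed
  \<comment> \<open>Sincere winners other than \<open>z'\<close> stay at the minimum, hence occur on
    both sides of the Kelly comparison; two of them would be ranked both ways.\<close>
  have sub: "?X - {z'} \<subseteq> ?Y"
    using min' unfolding X by (auto simp: least_vetoed_def trans_le_add1 le_SucI)
  have "u = w" if "u \<in> ?X - {z'}" "w \<in> ?X - {z'}" for u w
  proof -
    have "(u, w) \<in> q" "(w, u) \<in> q"
      using sub that better by blast+
    then show ?thesis
      using assms(2)
      by (auto simp: linear_orders_def linear_order_on_def partial_order_on_def dest: antisymD)
  qed
  then have "\<exists>y\<in>?X. ?X = {y, z'}"
    using z'X by (cases "?X - {z'} = {}") blast+
  then obtain y where y: "y \<in> ?X" "?X = {y, z'}" by blast
  have "c u > 0" if "u \<in> A - {y, z'}" for u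
    using that y(2) X min'[of u] by (cases "c u = 0") auto
  moreover have "y \<in> A" "y \<noteq> z" using y(1) zX XA by auto
  ultimately show ?thesis
    using y(2) \<open>z' \<noteq> z\<close> by (intro bexI[of _ y] conjI ballI)
qed

lemma kelly_strictD:
  assumes "strictly_prefers (kelly A q) B C"
  shows "B \<noteq> C" "\<forall>x\<in>B. \<forall>y\<in>C. (x, y) \<in> q"
  using assms by (auto simp: strictly_prefers_def kelly_def weakly_prefers_def)

section \<open>Manipulability of negative plurality\<close>

lemma negative_plurality_manipulationD:
  assumes "finite A" "A \<noteq> {}" "finite I" "i \<in> I" "q \<in> linear_orders A" "q' \<in> linear_orders A"
    and "p \<in> profiles A (I - {i})"
    and "strictly_prefers (kelly A q) (negative_plurality A I (p(i := q')))
      (negative_plurality A I (p(i := q)))"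
  shows "\<exists>y\<in>A. y \<noteq> bottom A q \<and> bottom A q' \<noteq> bottom A q \<and>
    negative_plurality A I (p(i := q)) = {y, bottom A q'} \<and>
    (\<forall>x\<in>A - {y, bottom A q'}. vetoes A (I - {i}) p x > 0)"
  using least_vetoed_improvement[OF assms(1,5) refl bottom_in[OF assms(1,2,6)]]
    kelly_strictD[OF assms(8)] assms
  by (simp add: negative_plurality_fun_upd)

text \<open>A successful manipulation requires the \<open>card I - 1\<close> others to veto all but
  at most two alternatives, and each casts only one veto.\<close>

lemma negative_plurality_K_strategy_proof:
  assumes "finite A" "A \<noteq> {}" "finite I" "card I < card A - 1"
  shows "K_strategy_proof A I (negative_plurality A I)"
  unfolding K_strategy_proof_def
proof
  assume "K_manipulable A I (negative_plurality A I)"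
  then obtain i q q' p where *: "i \<in> I" "q \<in> linear_orders A" "q' \<in> linear_orders A"
    "p \<in> profiles A (I - {i})"
    "strictly_prefers (kelly A q) (negative_plurality A I (p(i := q')))
      (negative_plurality A I (p(i := q)))"
    by (auto simp: K_manipulable_def)
  then obtain y z' where pos: "\<forall>x\<in>A - {y, z'}. vetoes A (I - {i}) p x > 0"
    using negative_plurality_manipulationD[OF assms(1-3)] by blast
  \<comment> \<open>Only an inequality, as \<open>y\<close> and \<open>z'\<close> may
    coincide.\<close>
  have "card A - 2 \<le> card A - card {y, z'}"
    by (intro diff_le_mono2) (simp add: card_insert_if)
  also have "\<dots> \<le> card (A - {y, z'})"
    by (rule diff_card_le_card_Diff) simp
  also have "\<dots> = (\<Sum>x\<in>A - {y, z'}. 1)" by simp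
  also have "\<dots> \<le> sum (vetoes A (I - {i}) p) (A - {y, z'})"
    using pos by (intro sum_mono) (simp add: Suc_le_eq)
  also have "\<dots> \<le> sum (vetoes A (I - {i}) p) A"
    using assms(1) by (intro sum_mono2) auto
  also have "\<dots> = card (I - {i})"
    using * assms by (intro sum_vetoes) auto
  also have "\<dots> = card I - 1"
    using * assms(3) by simp
  finally have "card A - 2 \<le> card I - 1" .
  \<comment> \<open>Rules out truncation in \<open>card I - 1\<close>.\<close>
  moreover have "card I > 0"
    using *(1) assms(3) card_gt_0_iff by blast
  ultimately show False using assms(4) by linarith
qed

lemma negative_plurality_winner_K_strategy_proof:
  assumes "finite A" "card A \<ge> 3" "finite I" "card I \<ge> card A - 1"
    and div: "card A = 3 \<Longrightarrow> 3 dvd card I - 1"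
  shows "winner_K_strategy_proof A I (negative_plurality A I)"
  unfolding winner_K_strategy_proof_def
proof
  have ne: "A \<noteq> {}" using assms(2) by auto
  assume "winner_K_manipulable A I (negative_plurality A I)"
  then obtain i q q' p X where *: "i \<in> I" "q \<in> linear_orders A" "q' \<in> linear_orders A"
    "p \<in> profiles A (I - {i})" "negative_plurality A I (p(i := q)) = X"
    "strictly_prefers (kelly A q) (negative_plurality A I (p(i := q')))
      (negative_plurality A I (p(i := q)))"
    and all: "\<forall>r\<in>profiles A (I - {i}). negative_plurality A I (r(i := q)) = X \<longrightarrow>
      weakly_prefers (kelly A q) (negative_plurality A I (r(i := q')))
        (negative_plurality A I (r(i := q)))"
    unfolding winner_K_manipulable_def winner_info_def by clarsimp blast
  define z z' where "z = bottom A q" and "z' = bottom A q'"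
  obtain y where y: "y \<in> A" "y \<noteq> z" "z' \<noteq> z" and X: "X = {y, z'}"
    using negative_plurality_manipulationD[OF assms(1) ne assms(3) *(1,2,3,4,6)] *(5)
    unfolding z_def z'_def by blast
  have A: "z \<in> A" "z' \<in> A"
    using bottom_in[OF assms(1) ne] *(2,3) by (auto simp: z_def z'_def)
  have card_I: "card (I - {i}) = card I - 1"
    using * assms(3) by simp
  \<comment> \<open>The counterexample inside the information set: \<open>y\<close>,
    \<open>z'\<close> and \<open>z\<close> share the minimum \<open>k\<close>, and everything else
    lies above it.\<close>
  have "\<exists>r\<in>profiles A (I - {i}). \<exists>k. \<forall>x\<in>A.
      vetoes A (I - {i}) r x \<ge> k \<and> (vetoes A (I - {i}) r x = k \<longleftrightarrow> x \<in> {y, z', z})"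
  proof (cases "A = {y, z', z}")
    case True
    then have "card A = 3"
      using assms(2) by (auto simp: card_insert_if split: if_splits)
    then obtain k where "card (I - {i}) = card A * k"
      using div card_I by (auto elim: dvdE)
    then obtain r where "r \<in> profiles A (I - {i})" "\<forall>x\<in>A. vetoes A (I - {i}) r x = k"
      using ex_profile_vetoes_const[of "I - {i}" A k] assms(1,3) ne by auto
    then show ?thesis using True by (intro bexI[of _ r] exI[of _ k]) auto
  next
    case False
    \<comment> \<open>Since \<open>y\<close> may equal \<open>z'\<close>, only two elements are
      guaranteed; that still leaves at most \<open>card A - 2\<close> alternatives for the others to
      veto, with \<open>k = 0\<close>.\<close>
    have "card {z, z'} \<le> card {y, z', z}"
      by (intro card_mono) auto
    then have "card (A - {y, z', z}) \<le> card A - 2"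
      using A y by (subst card_Diff_subset) auto
    then have "card (A - {y, z', z}) \<le> card (I - {i})"
      using assms(4) card_I by simp
    moreover have "A - {y, z', z} \<noteq> {}"
      using False A y by auto
    ultimately obtain r where "r \<in> profiles A (I - {i})"
        "\<forall>x. vetoes A (I - {i}) r x = 0 \<longleftrightarrow> x \<notin> A - {y, z', z}"
      using ex_profile_vetoes_support[of "I - {i}" A "A - {y, z', z}"] assms(1,3) by auto
    then show ?thesis by (intro bexI[of _ r] exI[of _ 0]) auto
  qed
  then obtain r k where r: "r \<in> profiles A (I - {i})"
    and ge: "\<And>x. x \<in> A \<Longrightarrow> vetoes A (I - {i}) r x \<ge> k"
    and eq: "\<And>x. x \<in> A \<Longrightarrow> vetoes A (I - {i}) r x = k \<longleftrightarrow> x \<in> {y, z', z}"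
    by blast
  have "negative_plurality A I (r(i := q)) = least_vetoed A (vetoes A (I - {i}) r) z"
    using * r assms by (simp add: negative_plurality_fun_upd z_def)
  also have "\<dots> = {y, z'}"
  proof -
    have "vetoes A (I - {i}) r y = k" "vetoes A (I - {i}) r z' = k" "vetoes A (I - {i}) r z = k"
      using eq y A by auto
    moreover have "vetoes A (I - {i}) r x > k" if "x \<in> A" "x \<notin> {y, z', z}" for x
      using ge eq that by (metis le_neq_implies_less)
    ultimately show ?thesis
      using y A ge unfolding least_vetoed_def by (fastforce simp: not_le trans_le_add1)
  qed
  finally have sincere: "negative_plurality A I (r(i := q)) = {y, z'}" .
  have "negative_plurality A I (r(i := q')) = least_vetoed A (vetoes A (I - {i}) r) z'"
    using * r assms by (simp add: negative_plurality_fun_upd z'_def)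
  moreover have "z \<in> least_vetoed A (vetoes A (I - {i}) r) z'"
    using eq[of z] ge A y by (auto simp: least_vetoed_def trans_le_add1)
  ultimately have zin: "z \<in> negative_plurality A I (r(i := q'))" by simp
  have "weakly_prefers (kelly A q) (negative_plurality A I (r(i := q')))
      (negative_plurality A I (r(i := q)))"
    using all r sincere X by blast
  \<comment> \<open>The outcomes differ because \<open>z\<close> belongs only to the first, so the
    Kelly relation must compare all pairs, contradicting that \<open>z\<close> is worst.\<close>
  then have "(z, z') \<in> q"
    using zin sincere y unfolding weakly_prefers_def kelly_def by auto
  then show False
    using le_bottomD[OF assms(1) ne *(2) A(2)] y(3) by (simp add: z_def)
qed

text \<open>Let the others veto exactly the alternatives outside \<open>{y, z'}\<close>, which takes
  \<open>card A - 2\<close> individuals. A veto of \<open>z\<close> then leaves \<open>y\<close> and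
  \<open>z'\<close> tied at zero, while a veto of \<open>z'\<close> breaks the tie in favour of
  \<open>y\<close>.\<close>

lemma ex_negative_plurality_manipulation:
  assumes "finite A" "card A \<ge> 3" "finite I" "card I \<ge> card A - 1"
  obtains i q q' p y z z' where "i \<in> I" "q \<in> linear_orders A" "q' \<in> linear_orders A"
    "p \<in> profiles A (I - {i})" "{y, z', z} \<subseteq> A" "distinct [y, z', z]"
    "bottom A q = z" "bottom A q' = z'" "(y, z') \<in> q"
    "negative_plurality A I (p(i := q)) = {y, z'}"
    "negative_plurality A I (p(i := q')) = {y}"
proof -
  obtain T where "T \<subseteq> A" "card T = 3"
    using assms(2) obtain_subset_with_card_n by metis
  then obtain y z' z where yz: "y \<in> A" "z' \<in> A" "z \<in> A" "y \<noteq> z'" "y \<noteq> z" "z' \<noteq> z"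
    by (auto simp: card_3_iff)
  have "I \<noteq> {}" using assms by auto
  then obtain i where i: "i \<in> I" by blast
  obtain q where q: "q \<in> linear_orders A" "bottom A q = z" "(y, z') \<in> q"
    using ex_linear_order_bottom_two[of z A z'] yz by blast
  obtain q' where q': "q' \<in> linear_orders A" "bottom A q' = z'"
    using ex_linear_order_bottom yz by metis
  have "card (A - {y, z'}) \<le> card (I - {i})"
    using assms i yz by (simp add: card_Diff_subset)
  then obtain p where p: "p \<in> profiles A (I - {i})"
      "\<forall>x. vetoes A (I - {i}) p x = 0 \<longleftrightarrow> x \<notin> A - {y, z'}"
    using ex_profile_vetoes_support[of "I - {i}" A "A - {y, z'}"] assms yz by auto
  let ?c = "vetoes A (I - {i}) p"
  have c: "?c y = 0" "?c z' = 0" "\<And>x. x \<in> A \<Longrightarrow> x \<noteq> y \<Longrightarrow> x \<noteq> z' \<Longrightarrow> ?c x > 0"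
    using p(2) by auto
  have "least_vetoed A ?c z = {y, z'}" "least_vetoed A ?c z' = {y}"
    using c yz unfolding least_vetoed_def by fastforce+
  then show thesis
    using that[OF i q(1) q'(1) p(1)] yz q q' p assms i
    by (simp add: negative_plurality_fun_upd)
qed

lemma kelly_singleton_strict:
  assumes "q \<in> linear_orders A" "y \<in> A" "z' \<in> A" "y \<noteq> z'" "(y, z') \<in> q"
  shows "strictly_prefers (kelly A q) {y} {y, z'}"
  using assms
  by (auto simp: strictly_prefers_def kelly_def weakly_prefers_def nonempty_subsets_def
      linear_orders_def linear_order_on_def partial_order_on_def preorder_on_def refl_on_def
      dest: antisymD)

lemma negative_plurality_K_manipulable:
  assumes "finite A" "card A \<ge> 3" "finite I" "card I \<ge> card A - 1"
  shows "K_manipulable A I (negative_plurality A I)"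
proof -
  from assms obtain i q q' p y z z' where "i \<in> I" "q \<in> linear_orders A" "q' \<in> linear_orders A"
    "p \<in> profiles A (I - {i})" "{y, z', z} \<subseteq> A" "distinct [y, z', z]"
    "bottom A q = z" "bottom A q' = z'" "(y, z') \<in> q"
    "negative_plurality A I (p(i := q)) = {y, z'}"
    "negative_plurality A I (p(i := q')) = {y}"
    by (rule ex_negative_plurality_manipulation)
  then show ?thesis
    unfolding K_manipulable_def using kelly_singleton_strict[of q A y z']
    by (metis distinct_length_2_or_more insert_subset)
qed

lemma negative_plurality_winner_K_manipulable:
  assumes "card A = 3" "finite I" "card I \<ge> 2" "\<not> 3 dvd card I - 1"
  shows "winner_K_manipulable A I (negative_plurality A I)"
proof -
  let ?F = "negative_plurality A I"
  have fin: "finite A" using assms(1) card_ge_0_finite[of A] by simp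
  obtain i q q' p y z z' where m: "i \<in> I" "q \<in> linear_orders A" "q' \<in> linear_orders A"
    "p \<in> profiles A (I - {i})" "{y, z', z} \<subseteq> A" "distinct [y, z', z]"
    "bottom A q = z" "bottom A q' = z'" "(y, z') \<in> q"
    "?F (p(i := q)) = {y, z'}" "?F (p(i := q')) = {y}"
    by (rule ex_negative_plurality_manipulation[of A I]) (use fin assms in simp_all)
  have A: "A = {y, z', z}"
    using m(5,6) assms(1) fin by (intro card_subset_eq[symmetric]) auto
  have strict: "strictly_prefers (kelly A q) {y} {y, z'}"
    using m by (intro kelly_singleton_strict) auto
  \<comment> \<open>The information set of the sincere outcome \<open>{y, z'}\<close>; vetoing
    \<open>z'\<close> has to give \<open>{y}\<close> on all of it.\<close>
  let ?\<omega> = "{r \<in> profiles A (I - {i}). ?F (r(i := q)) = {y, z'}}"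
  have outcome: "?F (r(i := q')) = {y}" if "r \<in> ?\<omega>" for r
  proof -
    let ?c = "vetoes A (I - {i}) r"
    have X: "least_vetoed A ?c z = {y, z'}"
      using negative_plurality_fun_upd[of A I i r q] that m fin assms(2) by simp
    then have "y \<in> least_vetoed A ?c z" "z' \<in> least_vetoed A ?c z" "z \<notin> least_vetoed A ?c z"
      using m(6) by auto
    then have "?c y = ?c z'" "?c y \<le> ?c z"
      using m(6) A by (auto simp: least_vetoed_def)
    moreover have "?c y + ?c z' + ?c z = card I - 1"
      using sum_vetoes[of A "I - {i}" r] that m(1,6) fin assms(2) by (simp add: A)
    \<comment> \<open>Equality of all three counts would make \<open>card I - 1\<close> a multiple
      of 3.\<close>
    ultimately have "?c y = ?c z'" "?c y < ?c z"
      using assms(4) by presburger+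
    then have "least_vetoed A ?c z' = {y}"
      using m(6) unfolding A least_vetoed_def by auto
    then show ?thesis
      using negative_plurality_fun_upd[of A I i r q'] that m fin assms(2) by simp
  qed
  have "{y, z'} \<in> ?F ` profiles A I"
    using profiles_update[OF m(1,4,2)] m(10) by (metis image_eqI)
  moreover have "?\<omega> \<noteq> {}" using m(4,10) by blast
  ultimately have "?\<omega> \<in> winner_info A I ?F i q"
    unfolding winner_info_def by blast
  moreover have
    "\<exists>r\<in>?\<omega>. strictly_prefers (kelly A q) (?F (r(i := q'))) (?F (r(i := q)))"
    using strict m by (intro bexI[of _ p]) auto
  moreover have "\<forall>r\<in>?\<omega>. weakly_prefers (kelly A q) (?F (r(i := q'))) (?F (r(i := q)))"
    using strict outcome by (simp add: strictly_prefers_def weakly_prefers_def)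
  ultimately show ?thesis
    unfolding winner_K_manipulable_def
    by (intro bexI[of _ i] bexI[of _ q] bexI[of _ q'] bexI[of _ ?\<omega>] conjI m(1-3))
qed

theorem theorem18:
  fixes A :: "'a set" and I :: "'i set"
  assumes "finite A" and "card A \<ge> 2" and "finite I" and "card I \<ge> 2"
  shows
    "(card A = 3 \<and> 3 dvd card I - 1 \<longrightarrow>
        K_manipulable A I (negative_plurality A I) \<and>
        winner_K_strategy_proof A I (negative_plurality A I)) \<and>
     (card A = 3 \<and> \<not> 3 dvd card I - 1 \<longrightarrow>
        winner_K_manipulable A I (negative_plurality A I)) \<and>
     (card A \<ge> 4 \<and> card I < card A - 1 \<longrightarrow>
        K_strategy_proof A I (negative_plurality A I)) \<and>
     (card A \<ge> 4 \<and> card I \<ge> card A - 1 \<longrightarrow>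
        K_manipulable A I (negative_plurality A I) \<and>
        winner_K_strategy_proof A I (negative_plurality A I))"
proof -
  have "A \<noteq> {}" using assms(2) by auto
  then show ?thesis
    using assms negative_plurality_K_manipulable[of A I]
      negative_plurality_winner_K_strategy_proof[of A I]
      negative_plurality_winner_K_manipulable[of A I] negative_plurality_K_strategy_proof[of A I]
    by auto
qed

end
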